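(* Let $R$ be a non-commutative finite ring. Then $|\operatorname{Cent}(R)| = 4$ if and only if $d(R) = \frac{5}{8}$.
   Context: Rings are associative and not assumed to have a unity. For $r \in R$, the centralizer of $r$ is the subring $C(r) = \{s \in R : rs = sr\}$, and $\operatorname{Cent}(R) = \{C(r) : r \in R\}$ is the set of all distinct centralizers. The commutativity degree of a finite ring $R$ is $d(R) = \frac{1}{|R|^2}\sum_{r \in R} |C(r)|$, i.e. the probability that a randomly chosen pair of elements of $R$ commutes. *)

theory Defs
  imports Complex_Main
begin

text \<open>The type class \<open>ring\<close> of HOL is the class of associative rings without any
  requirement of a unity, so a finite ring is a type \<open>'a :: {ring, finite}\<close>.\<close>

definition centralizer :: "'a::ring \<Rightarrow> 'a set" where
  "centralizer r = {s. r * s = s * r}"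

definition Cent :: "'a::ring itself \<Rightarrow> 'a set set" where
  "Cent R = {centralizer r |r::'a. True}"

definition commutativity_degree :: "'a::{ring, finite} itself \<Rightarrow> real" where
  "commutativity_degree R =
     1 / (real (card (UNIV :: 'a set)))\<^sup>2 * (\<Sum>r\<in>(UNIV :: 'a set). real (card (centralizer r)))"

end

theory Submission
  imports Defs
begin

text \<open>
  Both conditions say that the centre \<open>Z\<close> has index 4 in the additive group of \<open>R\<close>.

  Let \<open>x\<close> and \<open>y\<close> be elements that do not commute. The elements \<open>0\<close>, \<open>x\<close>, \<open>y\<close> and \<open>x + y\<close> have
  pairwise different centralizers. A centralizer depends only on the coset of \<open>Z\<close>, so these four
  elements lie in different cosets and the index is at least 4. If the index is exactly 4, the
  four cosets fill \<open>R\<close> and there are no further centralizers. Conversely, if there are only four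
  centralizers, then elements with the same centralizer differ by a central element
  (\<open>same_centralizer_imp_diff_central\<close>), so the four cosets fill \<open>R\<close>.

  For the commutativity degree, write \<open>n\<close> and \<open>z\<close> for the orders of \<open>R\<close> and \<open>Z\<close>. The centralizer
  of a central element has order \<open>n\<close>, and that of a noncentral element has order between
  \<open>2 * z\<close> and \<open>n / 2\<close>. The upper bound gives \<open>d(R) \<le> (1 + z / n) / 2\<close>, so degree \<open>5 / 8\<close> forces
  \<open>n \<le> 4 * z\<close>, hence index 4. At index 4 the two bounds agree, so the estimate of the degree is
  an equality.
\<close>

section \<open>The centre and its cosets\<close>

definition center :: "'a::ring set" where
  "center = {z. \<forall>s. z * s = s * z}"

lemma Cent_eq_range: "Cent TYPE('a::ring) = range (centralizer :: 'a \<Rightarrow> 'a set)"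
  by (auto simp: Cent_def)

lemma centralizer_add_central:
  assumes "z \<in> center"
  shows "centralizer (a + z) = centralizer a"
  using assms by (auto simp: center_def centralizer_def algebra_simps)

lemma central_iff_centralizer_UNIV: "r \<in> center \<longleftrightarrow> centralizer r = UNIV"
  by (auto simp: center_def centralizer_def)

lemma centralizers_distinct:
  fixes x y :: "'a::ring"
  assumes "x * y \<noteq> y * x"
  shows "inj_on centralizer {0, x, y, x + y}" and "card {0, x, y, x + y} = 4"
proof -
  have ne: "y \<notin> centralizer x" "x \<notin> centralizer y" "y \<notin> centralizer (x + y)"
      "x \<notin> centralizer (x + y)"
    using assms by (auto simp: centralizer_def algebra_simps)
  have mem: "x \<in> centralizer x" "y \<in> centralizer y" "x \<in> centralizer 0" "y \<in> centralizer 0"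
    by (auto simp: centralizer_def)
  have d: "centralizer 0 \<noteq> centralizer x" "centralizer 0 \<noteq> centralizer y"
      "centralizer 0 \<noteq> centralizer (x + y)" "centralizer x \<noteq> centralizer y"
      "centralizer x \<noteq> centralizer (x + y)" "centralizer y \<noteq> centralizer (x + y)"
    using ne mem by blast+
  show "inj_on centralizer {0, x, y, x + y}"
    using d d[symmetric] by (simp add: inj_on_def)
  have "0 \<noteq> x" "0 \<noteq> y" "0 \<noteq> x + y" "x \<noteq> y" "x \<noteq> x + y" "y \<noteq> x + y"
    using d by metis+
  then show "card {0, x, y, x + y} = 4"
    by simp
qed

lemma cosets_disjoint:
  fixes A :: "'a::ring set"
  assumes "inj_on centralizer A"
  shows "inj_on (\<lambda>(a, z). a + z) (A \<times> center)"
proof (rule inj_onI, clarsimp)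
  fix a z b w :: 'a
  assume *: "a \<in> A" "z \<in> center" "b \<in> A" "w \<in> center" "a + z = b + w"
  then have "centralizer a = centralizer b"
    by (metis centralizer_add_central)
  then have "a = b"
    using assms * by (simp add: inj_on_eq_iff)
  then show "a = b \<and> z = w"
    using * by simp
qed

lemma card_cosets:
  fixes x y :: "'a::{ring, finite}"
  assumes "x * y \<noteq> y * x"
  shows "card ((\<lambda>(a, z). a + z) ` ({0, x, y, x + y} \<times> center)) = 4 * card (center :: 'a set)"
  by (subst card_image[OF cosets_disjoint[OF centralizers_distinct(1)[OF assms]]])
    (simp only: card_cartesian_product centralizers_distinct(2)[OF assms])

lemma four_card_center_le:
  assumes "\<exists>x y :: 'a::{ring, finite}. x * y \<noteq> y * x"
  shows "4 * card (center :: 'a set) \<le> card (UNIV :: 'a set)"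
proof -
  obtain x y :: 'a where "x * y \<noteq> y * x"
    using assms by blast
  from card_cosets[OF this] show ?thesis
    by (metis card_mono finite subset_UNIV)
qed

section \<open>Rings with four centralizers\<close>

text \<open>
  The element \<open>r + v\<close> commutes with neither \<open>u\<close> nor \<open>v\<close>, which leaves only the centralizer of
  \<open>u + v\<close> for it. So \<open>r + v\<close> commutes with \<open>u + v\<close>, and expanding this relation shows that \<open>r - u\<close>
  commutes with \<open>v\<close>. It commutes with \<open>u\<close> as well, and among the four centralizers only the whole
  ring contains both \<open>u\<close> and \<open>v\<close>.
\<close>

lemma same_centralizer_imp_diff_central:
  fixes u v r :: "'a::ring"
  assumes uv: "u * v \<noteq> v * u"
    and four: "range centralizer = centralizer ` {0, u, v, u + v}"
    and same: "centralizer r = centralizer u"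
  shows "r - u \<in> center"
proof -
  have cases4: "centralizer s = UNIV \<or> centralizer s = centralizer u
      \<or> centralizer s = centralizer v \<or> centralizer s = centralizer (u + v)" for s
  proof -
    have "centralizer s \<in> centralizer ` {0, u, v, u + v}"
      using four by blast
    moreover have "centralizer (0 :: 'a) = UNIV"
      by (simp add: centralizer_def)
    ultimately show ?thesis
      by auto
  qed
  have ru: "r * u = u * r"
    using same by (auto simp: centralizer_def)
  have rv: "r * v \<noteq> v * r"
    using same uv by (auto simp: centralizer_def)
  have "u \<notin> centralizer (r + v)" "v \<notin> centralizer (r + v)"
    using ru rv uv by (auto simp: centralizer_def algebra_simps)
  moreover have self: "s \<in> centralizer s" for s :: 'a
    by (simp add: centralizer_def)
  ultimately have "centralizer (r + v) = centralizer (u + v)"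
    using cases4[of "r + v"] by blast
  then have "(r + v) * (u + v) = (u + v) * (r + v)"
    using self[of "u + v"] by (auto simp: centralizer_def)
  then have "r * v + v * u = u * v + v * r"
    using ru by (simp add: algebra_simps)
  then have "r * v - u * v = v * r - v * u"
    by (simp add: algebra_simps)
  then have "u \<in> centralizer (r - u)" "v \<in> centralizer (r - u)"
    using ru by (simp_all add: centralizer_def algebra_simps)
  moreover have "v \<notin> centralizer u" "u \<notin> centralizer v" "u \<notin> centralizer (u + v)"
    using uv by (auto simp: centralizer_def algebra_simps)
  ultimately have "centralizer (r - u) = UNIV"
    using cases4[of "r - u"] by blast
  then show ?thesis
    by (simp add: central_iff_centralizer_UNIV)
qed

lemma cosets_cover_if_four_centralizers:
  fixes x y :: "'a::ring"
  assumes xy: "x * y \<noteq> y * x"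
    and four: "range centralizer = centralizer ` {0, x, y, x + y}"
  shows "(\<lambda>(a, z). a + z) ` ({0, x, y, x + y} \<times> center) = UNIV"
proof -
  have near: "\<exists>a\<in>{0, x, y, x + y}. r - a \<in> center" for r :: 'a
  proof -
    obtain a where a: "a \<in> {0, x, y, x + y}" "centralizer r = centralizer a"
      using four by blast
    \<comment> \<open>The centralizers form the same set for the pairs \<open>(y, x)\<close> and \<open>(x + y, - y)\<close>: the sums of
      these pairs are \<open>x + y\<close> and \<open>x\<close>, and \<open>- y\<close> has the centralizer of \<open>y\<close>.\<close>
    have neg: "centralizer (- y) = centralizer y"
      by (auto simp: centralizer_def)
    have "r - a \<in> center"
    proof -
      consider "a = 0" | "a = x" | "a = y" | "a = x + y"
        using a(1) by blast
      then show ?thesis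
      proof cases
        case 1
        then show ?thesis
          using a(2) by (simp add: central_iff_centralizer_UNIV) (simp add: centralizer_def)
      next
        case 2
        then show ?thesis
          using same_centralizer_imp_diff_central[OF xy four] a(2) by simp
      next
        case 3
        have "range centralizer = centralizer ` {0, y, x, y + x}"
          using four by (simp add: insert_commute add.commute)
        then show ?thesis
          using same_centralizer_imp_diff_central[of y x r] xy a(2) 3 by simp
      next
        case 4
        have "range centralizer = centralizer ` {0, x + y, - y, (x + y) + - y}"
          using four neg by auto
        moreover have "(x + y) * - y \<noteq> - y * (x + y)"
          using xy by (simp add: algebra_simps)
        ultimately show ?thesis
          using same_centralizer_imp_diff_central[of "x + y" "- y" r] a(2) 4 by simp
      qed
    qed
    then show ?thesis
      using a(1) by blast
  qed
  have "r \<in> (\<lambda>(a, z). a + z) ` ({0, x, y, x + y} \<times> center)" for r :: 'a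
  proof -
    obtain a where a: "a \<in> {0, x, y, x + y}" "r - a \<in> center"
      using near by blast
    show ?thesis
      by (rule image_eqI[where x = "(a, r - a)"]) (use a in simp_all)
  qed
  then show ?thesis
    by blast
qed

lemma four_centralizers_iff:
  assumes "\<exists>x y :: 'a::{ring, finite}. x * y \<noteq> y * x"
  shows "card (Cent TYPE('a)) = 4 \<longleftrightarrow> 4 * card (center :: 'a set) = card (UNIV :: 'a set)"
proof -
  obtain x y :: 'a where xy: "x * y \<noteq> y * x"
    using assms by blast
  let ?Q = "{0, x, y, x + y}"
  let ?S = "(\<lambda>(a, z). a + z) ` (?Q \<times> center)"
  have card_Q: "card (centralizer ` ?Q) = 4"
    by (simp only: card_image[OF centralizers_distinct(1)[OF xy]] centralizers_distinct(2)[OF xy])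
  show ?thesis
  proof
    assume "card (Cent TYPE('a)) = 4"
    then have "centralizer ` ?Q = range (centralizer :: 'a \<Rightarrow> 'a set)"
      using card_Q by (intro card_subset_eq) (auto simp: Cent_eq_range)
    from cosets_cover_if_four_centralizers[OF xy this[symmetric]]
    show "4 * card (center :: 'a set) = card (UNIV :: 'a set)"
      using card_cosets[OF xy] by simp
  next
    assume "4 * card (center :: 'a set) = card (UNIV :: 'a set)"
    then have cover: "?S = UNIV"
      using card_cosets[OF xy] by (intro card_subset_eq) auto
    have "centralizer r \<in> centralizer ` ?Q" for r :: 'a
    proof -
      have "r \<in> ?S"
        using cover by blast
      then obtain p where p: "p \<in> ?Q \<times> center" "r = fst p + snd p"
        by (elim imageE) (simp only: case_prod_beta)
      then have "centralizer r = centralizer (fst p)"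
        by (simp only: mem_Times_iff centralizer_add_central)
      moreover have "fst p \<in> ?Q"
        using p(1) by (simp only: mem_Times_iff)
      ultimately show ?thesis
        by (simp only: imageI)
    qed
    then have "range (centralizer :: 'a \<Rightarrow> 'a set) = centralizer ` ?Q"
      by blast
    then show "card (Cent TYPE('a)) = 4"
      using card_Q by (simp only: Cent_eq_range)
  qed
qed

section \<open>The commutativity degree\<close>

text \<open>
  A proper centralizer is disjoint from its translate by an element outside it, so it has index at
  least 2. It contains the disjoint sets \<open>Z\<close> and \<open>r + Z\<close>.
\<close>

lemma card_centralizer_bounds:
  fixes r :: "'a::{ring, finite}"
  assumes "r \<notin> center"
  shows "2 * card (centralizer r) \<le> card (UNIV :: 'a set)"
    and "2 * card (center :: 'a set) \<le> card (centralizer r)"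
proof -
  obtain s where s: "s \<notin> centralizer r"
    using assms by (auto simp: central_iff_centralizer_UNIV)
  have "centralizer r \<inter> (+) s ` centralizer r = {}"
    using s by (auto simp: centralizer_def algebra_simps)
  then have "card (centralizer r \<union> (+) s ` centralizer r) = 2 * card (centralizer r)"
    by (simp add: card_Un_disjoint card_image)
  then show "2 * card (centralizer r) \<le> card (UNIV :: 'a set)"
    by (metis card_mono finite subset_UNIV)
  have "center \<inter> (+) r ` center = {}"
    using assms centralizer_add_central[of _ r] by (auto simp: central_iff_centralizer_UNIV)
  then have "card (center \<union> (+) r ` center) = 2 * card (center :: 'a set)"
    by (simp add: card_Un_disjoint card_image)
  moreover have "center \<union> (+) r ` center \<subseteq> centralizer r"
    by (auto simp: center_def centralizer_def algebra_simps)
  ultimately show "2 * card (center :: 'a set) \<le> card (centralizer r)"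
    by (metis card_mono finite)
qed

lemma sum_card_centralizers:
  "(\<Sum>r\<in>(UNIV :: 'a::{ring, finite} set). real (card (centralizer r)))
    = real (card (center :: 'a set)) * real (card (UNIV :: 'a set))
      + (\<Sum>r\<in>- (center :: 'a set). real (card (centralizer r)))"
proof -
  have "(\<Sum>r\<in>(UNIV :: 'a set). real (card (centralizer r)))
      = (\<Sum>r\<in>(center :: 'a set). real (card (centralizer r)))
        + (\<Sum>r\<in>- (center :: 'a set). real (card (centralizer r)))"
    by (subst sum.union_disjoint[symmetric]) auto
  then show ?thesis
    by (simp add: central_iff_centralizer_UNIV)
qed

lemma commutativity_degree_five_eighths_iff:
  assumes "\<exists>x y :: 'a::{ring, finite}. x * y \<noteq> y * x"
  shows "commutativity_degree TYPE('a) = 5 / 8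
    \<longleftrightarrow> 4 * card (center :: 'a set) = card (UNIV :: 'a set)"
proof -
  define n where "n = real (card (UNIV :: 'a set))"
  define z where "z = real (card (center :: 'a set))"
  define S where "S = (\<Sum>r\<in>- (center :: 'a set). real (card (centralizer r)))"
  have n_pos: "n > 0"
    by (simp add: n_def finite_UNIV_card_ge_0)
  have card_compl: "real (card (- (center :: 'a set))) = n - z"
    by (simp add: n_def z_def Compl_eq_Diff_UNIV card_Diff_subset card_mono of_nat_diff)
  have degree: "commutativity_degree TYPE('a) = (z * n + S) / n\<^sup>2"
    by (simp add: commutativity_degree_def sum_card_centralizers n_def z_def S_def)
  have upper: "real (card (centralizer r)) \<le> n / 2" if "r \<in> - (center :: 'a set)" for r
    using card_centralizer_bounds(1)[of r] that by (simp add: n_def)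
  have index_ge_4: "4 * z \<le> n"
    using four_card_center_le[OF assms] unfolding n_def z_def by linarith
  have index_4: "4 * card (center :: 'a set) = card (UNIV :: 'a set) \<longleftrightarrow> 4 * z = n"
    unfolding n_def z_def by linarith
  have "commutativity_degree TYPE('a) = 5 / 8 \<longleftrightarrow> 4 * z = n"
  proof
    assume "commutativity_degree TYPE('a) = 5 / 8"
    then have "z * n + S = 5 / 8 * n\<^sup>2"
      using n_pos by (simp add: degree field_simps)
    moreover have "S \<le> (n - z) * (n / 2)"
      unfolding S_def card_compl[symmetric] by (rule sum_bounded_above) (rule upper)
    ultimately have "n * n \<le> n * (4 * z)"
      by (simp add: algebra_simps power2_eq_square)
    then have "n \<le> 4 * z"
      using n_pos by simp
    then show "4 * z = n"
      using index_ge_4 by simp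
  next
    assume eq: "4 * z = n"
    have "real (card (centralizer r)) = n / 2" if "r \<in> - (center :: 'a set)" for r
    proof -
      have "2 * z \<le> real (card (centralizer r))"
        using card_centralizer_bounds(2)[of r] that unfolding z_def by simp
      then show ?thesis
        using upper[OF that] eq by simp
    qed
    then have "S = (\<Sum>r\<in>- (center :: 'a set). n / 2)"
      unfolding S_def by (intro sum.cong) auto
    then have "S = (n - z) * (n / 2)"
      by (simp add: card_compl)
    moreover have "z = n / 4"
      using eq by simp
    ultimately show "commutativity_degree TYPE('a) = 5 / 8"
      using n_pos by (simp add: degree field_simps power2_eq_square)
  qed
  then show ?thesis
    by (simp only: index_4)
qed

theorem proposition5p1:
  assumes noncommutative: "\<exists>x y :: 'a::{ring, finite}. x * y \<noteq> y * x"
  shows "card (Cent TYPE('a)) = 4 \<longleftrightarrow> commutativity_degree TYPE('a) = 5 / 8"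
  by (simp only: four_centralizers_iff[OF noncommutative]
      commutativity_degree_five_eighths_iff[OF noncommutative])

end
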